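(* Let $n\ge2$, let $\mathfrak g$ be an $n$-Lie algebra, and let $E=\mathfrak g\oplus V$ be a vector space containing $\mathfrak g$ with chosen complement $V$ and associated projections $\mathrm{pr}_{\mathfrak g}:E\to\mathfrak g$, $\mathrm{pr}_V:E\to V$. Every $n$-Lie bracket $[-,\dots,-]_E$ on $E$ which contains $\mathfrak g$ as a subalgebra and is extreme with respect to $V$ is an action-form unified product. More precisely, it determines the extreme action datum $\Omega$ given by $$\begin{aligned}\vartheta_V(u)(x_2,\dots,x_n)&=\mathrm{pr}_{\mathfrak g}[u,x_2,\dots,x_n]_E,&\rho_{\mathfrak g}(x_1,\dots,x_{n-1})u&=\mathrm{pr}_V[x_1,\dots,x_{n-1},u]_E,\\ \rho_V(u_1,\dots,u_{n-1})x&=\mathrm{pr}_{\mathfrak g}[u_1,\dots,u_{n-1},x]_E,&\vartheta_{\mathfrak g}(x)(u_1,\dots,u_{n-1})&=\mathrm{pr}_V[u_1,\dots,u_{n-1},x]_E,\\ \omega(u_1,\dots,u_n)&=\mathrm{pr}_{\mathfrak g}[u_1,\dots,u_n]_E,&\{u_1,\dots,u_n\}_V&=\mathrm{pr}_V[u_1,\dots,u_n]_E,\end{aligned}$$ and the identity map of $\mathfrak g\oplus V$ identifies the given bracket with $[-,\dots,-]_\Omega$. Conversely, every extreme action datum $\Omega$ satisfying the compatibility identities defines, through $[-,\dots,-]_\Omega$, an $n$-Lie bracket on $\mathfrak g\oplus V$ containing $\mathfrak g$ as a subalgebra and extreme with respect to $V$.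
   Context: $K$ is a field of characteristic zero; vector spaces are over $K$, all maps are linear; a hat denotes omission. An $n$-Lie algebra is a vector space with an alternating $n$-linear bracket (an $n$-Lie bracket) satisfying $[z_1,\dots,z_{n-1},[w_1,\dots,w_n]]=\sum_{i=1}^n[w_1,\dots,w_{i-1},[z_1,\dots,z_{n-1},w_i],w_{i+1},\dots,w_n]$. A bracket on $E$ contains $\mathfrak g$ as a subalgebra if its restriction to $\mathfrak g$ is the given bracket of $\mathfrak g$. It is extreme with respect to $V$ if $[u_1,\dots,u_k,x_{k+1},\dots,x_n]_E=0$ for all $2\le k\le n-2$, $u_i\in V$, $x_j\in\mathfrak g$ (no condition if there is no such $k$, e.g. if $n=3$). An extreme action datum of $\mathfrak g$ through $V$ is a sextuple $\Omega=(\rho_{\mathfrak g},\rho_V,\vartheta_V,\vartheta_{\mathfrak g},\omega,\{-,\dots,-\}_V)$ of linear maps $\rho_{\mathfrak g}:\bigwedge^{n-1}\mathfrak g\to\mathrm{End}(V)$, $\rho_V:\bigwedge^{n-1}V\to\mathrm{End}(\mathfrak g)$, $\vartheta_V:V\to\mathrm{Hom}(\bigwedge^{n-1}\mathfrak g,\mathfrak g)$, $\vartheta_{\mathfrak g}:\mathfrak g\to\mathrm{Hom}(\bigwedge^{n-1}V,V)$, $\omega:\bigwedge^nV\to\mathfrak g$, $\{-,\dots,-\}_V:\bigwedge^nV\to V$. Define $$\begin{aligned}G(x_1,u_1;\dots;x_n,u_n)={}&[x_1,\dots,x_n]_{\mathfrak g}+\omega(u_1,\dots,u_n)+\sum_{i=1}^n(-1)^{i-1}\vartheta_V(u_i)(x_1,\dots,\widehat{x_i},\dots,x_n)\\&+\sum_{i=1}^n(-1)^{n-i}\rho_V(u_1,\dots,\widehat{u_i},\dots,u_n)x_i,\\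 H(x_1,u_1;\dots;x_n,u_n)={}&\{u_1,\dots,u_n\}_V+\sum_{i=1}^n(-1)^{n-i}\rho_{\mathfrak g}(x_1,\dots,\widehat{x_i},\dots,x_n)u_i\\&+\sum_{i=1}^n(-1)^{n-i}\vartheta_{\mathfrak g}(x_i)(u_1,\dots,\widehat{u_i},\dots,u_n),\end{aligned}$$ and $[x_1+u_1,\dots,x_n+u_n]_\Omega=G(x_1,u_1;\dots;x_n,u_n)+H(x_1,u_1;\dots;x_n,u_n)$ on $\mathfrak g\oplus V$. When this is an $n$-Lie bracket, $(\mathfrak g\oplus V,[-,\dots,-]_\Omega)$ is called the action-form unified product. Compatibility identities: for all $x_1,\dots,x_{n-1},y_1,\dots,y_n\in\mathfrak g$ and $u_1,\dots,u_{n-1},v_1,\dots,v_n\in V$, with $G_0=G(y_1,v_1;\dots;y_n,v_n)$, $H_0=H(y_1,v_1;\dots;y_n,v_n)$, $G_i=G(x_1,u_1;\dots;x_{n-1},u_{n-1};y_i,v_i)$, $H_i=H(x_1,u_1;\dots;x_{n-1},u_{n-1};y_i,v_i)$, for each $F\in\{G,H\}$: $$F(x_1,u_1;\dots;x_{n-1},u_{n-1};G_0,H_0)=\sum_{i=1}^nF(y_1,v_1;\dots;y_{i-1},v_{i-1};G_i,H_i;y_{i+1},v_{i+1};\dots;y_n,v_n).$$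
   Formalization: That the displayed Ω gives back the given bracket is stated only for n≥3: for n=2 the displayed formulas count each mixed component twice (e.g. [x,u]_E=u yields [x,u]_Ω=2u). For n=2 the bracket is still shown to be an action-form unified product for some Ω. *)

theory Defs
  imports Complex_Main "HOL-Library.NList"
begin

(* All vector spaces are subspaces of one ambient space (the type 'e with scalar
   multiplication s), and maps are only constrained on them.  A k-tuple of elements of S is
   an element of "nlists k S"; positions are counted from 0, so the exponents i - 1 and n - i
   of the usual 1-based formulas appear as i and n - Suc i.
   The base field of characteristic zero is the sort field_char_0 of 'k. *)

definition linear_between ::
  "('k::field_char_0 \<Rightarrow> 'e::ab_group_add \<Rightarrow> 'e) \<Rightarrow> 'e set \<Rightarrow> 'e set \<Rightarrow> ('e \<Rightarrow> 'e) \<Rightarrow> bool"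
  where "linear_between s S T f \<longleftrightarrow>
    (\<forall>a\<in>S. f a \<in> T) \<and>
    (\<forall>a\<in>S. \<forall>b\<in>S. f (a + b) = f a + f b) \<and>
    (\<forall>c. \<forall>a\<in>S. f (s c a) = s c (f a))"

(* A linear map from the k-th exterior power of S to T. *)
definition alternating_multilinear ::
  "('k::field_char_0 \<Rightarrow> 'e::ab_group_add \<Rightarrow> 'e) \<Rightarrow> nat \<Rightarrow> 'e set \<Rightarrow> 'e set \<Rightarrow> ('e list \<Rightarrow> 'e) \<Rightarrow> bool"
  where "alternating_multilinear s k S T f \<longleftrightarrow>
    (\<forall>xs\<in>nlists k S. \<forall>i<k. linear_between s S T (\<lambda>a. f (xs[i := a]))) \<and>
    (\<forall>xs\<in>nlists k S. \<forall>i j. i < j \<and> j < k \<and> xs ! i = xs ! j \<longrightarrow> f xs = 0)"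

definition n_lie_bracket ::
  "('k::field_char_0 \<Rightarrow> 'e::ab_group_add \<Rightarrow> 'e) \<Rightarrow> nat \<Rightarrow> 'e set \<Rightarrow> ('e list \<Rightarrow> 'e) \<Rightarrow> bool"
  where "n_lie_bracket s n S br \<longleftrightarrow>
    alternating_multilinear s n S S br \<and>
    (\<forall>zs\<in>nlists (n - 1) S. \<forall>ws\<in>nlists n S.
      br (zs @ [br ws]) = (\<Sum>i<n. br (ws[i := br (zs @ [ws ! i])])))"

definition direct_decomposition ::
  "('k::field_char_0 \<Rightarrow> 'e::ab_group_add \<Rightarrow> 'e) \<Rightarrow> 'e set \<Rightarrow> 'e set \<Rightarrow> bool"
  where "direct_decomposition s A B \<longleftrightarrow>
    module.subspace s A \<and> module.subspace s B \<and> A \<inter> B = {0} \<and>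
    (\<forall>z. \<exists>a\<in>A. \<exists>b\<in>B. z = a + b)"

(* Projection onto A along B. *)
definition proj :: "'e::ab_group_add set \<Rightarrow> 'e set \<Rightarrow> 'e \<Rightarrow> 'e"
  where "proj A B z = (THE a. a \<in> A \<and> z - a \<in> B)"

definition contains_subalgebra ::
  "nat \<Rightarrow> 'e set \<Rightarrow> ('e list \<Rightarrow> 'e) \<Rightarrow> ('e list \<Rightarrow> 'e) \<Rightarrow> bool"
  where "contains_subalgebra n g brg brE \<longleftrightarrow> (\<forall>xs\<in>nlists n g. brE xs = brg xs)"

definition extreme ::
  "nat \<Rightarrow> 'e::ab_group_add set \<Rightarrow> 'e set \<Rightarrow> ('e list \<Rightarrow> 'e) \<Rightarrow> bool"
  where "extreme n g V brE \<longleftrightarrow>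
    (\<forall>k. 2 \<le> k \<and> k \<le> n - 2 \<longrightarrow>
      (\<forall>us\<in>nlists k V. \<forall>xs\<in>nlists (n - k) g. brE (us @ xs) = 0))"

record 'e action_datum =
  rho_g :: "'e list \<Rightarrow> 'e \<Rightarrow> 'e"
  rho_V :: "'e list \<Rightarrow> 'e \<Rightarrow> 'e"
  theta_V :: "'e \<Rightarrow> 'e list \<Rightarrow> 'e"
  theta_g :: "'e \<Rightarrow> 'e list \<Rightarrow> 'e"
  omega :: "'e list \<Rightarrow> 'e"
  curly :: "'e list \<Rightarrow> 'e"

(* The operations on End and Hom spaces are pointwise, so a linear map from an exterior power
   to End(V), or from V to Hom(exterior power, g), is a map of two arguments that is linear in
   the single vector and alternating multilinear in the tuple. *)
definition extreme_action_datum ::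
  "('k::field_char_0 \<Rightarrow> 'e::ab_group_add \<Rightarrow> 'e) \<Rightarrow> nat \<Rightarrow> 'e set \<Rightarrow> 'e set \<Rightarrow>
    'e action_datum \<Rightarrow> bool"
  where "extreme_action_datum s n g V \<Omega> \<longleftrightarrow>
    (\<forall>xs\<in>nlists (n - 1) g. linear_between s V V (rho_g \<Omega> xs)) \<and>
    (\<forall>u\<in>V. alternating_multilinear s (n - 1) g V (\<lambda>xs. rho_g \<Omega> xs u)) \<and>
    (\<forall>us\<in>nlists (n - 1) V. linear_between s g g (rho_V \<Omega> us)) \<and>
    (\<forall>x\<in>g. alternating_multilinear s (n - 1) V g (\<lambda>us. rho_V \<Omega> us x)) \<and>
    (\<forall>xs\<in>nlists (n - 1) g. linear_between s V g (\<lambda>u. theta_V \<Omega> u xs)) \<and>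
    (\<forall>u\<in>V. alternating_multilinear s (n - 1) g g (theta_V \<Omega> u)) \<and>
    (\<forall>us\<in>nlists (n - 1) V. linear_between s g V (\<lambda>x. theta_g \<Omega> x us)) \<and>
    (\<forall>x\<in>g. alternating_multilinear s (n - 1) V V (theta_g \<Omega> x)) \<and>
    alternating_multilinear s n V g (omega \<Omega>) \<and>
    alternating_multilinear s n V V (curly \<Omega>)"

definition omit :: "nat \<Rightarrow> 'a list \<Rightarrow> 'a list"
  where "omit i xs = take i xs @ drop (Suc i) xs"

definition G_part ::
  "('k::field_char_0 \<Rightarrow> 'e::ab_group_add \<Rightarrow> 'e) \<Rightarrow> nat \<Rightarrow> ('e list \<Rightarrow> 'e) \<Rightarrow> 'e action_datum \<Rightarrow>
    'e list \<Rightarrow> 'e list \<Rightarrow> 'e"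
  where "G_part s n brg \<Omega> xs us =
    brg xs + omega \<Omega> us
    + (\<Sum>i<n. s ((- 1) ^ i) (theta_V \<Omega> (us ! i) (omit i xs)))
    + (\<Sum>i<n. s ((- 1) ^ (n - Suc i)) (rho_V \<Omega> (omit i us) (xs ! i)))"

definition H_part ::
  "('k::field_char_0 \<Rightarrow> 'e::ab_group_add \<Rightarrow> 'e) \<Rightarrow> nat \<Rightarrow> 'e action_datum \<Rightarrow>
    'e list \<Rightarrow> 'e list \<Rightarrow> 'e"
  where "H_part s n \<Omega> xs us =
    curly \<Omega> us
    + (\<Sum>i<n. s ((- 1) ^ (n - Suc i)) (rho_g \<Omega> (omit i xs) (us ! i)))
    + (\<Sum>i<n. s ((- 1) ^ (n - Suc i)) (theta_g \<Omega> (xs ! i) (omit i us)))"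

definition datum_bracket ::
  "('k::field_char_0 \<Rightarrow> 'e::ab_group_add \<Rightarrow> 'e) \<Rightarrow> nat \<Rightarrow> 'e set \<Rightarrow> 'e set \<Rightarrow>
    ('e list \<Rightarrow> 'e) \<Rightarrow> 'e action_datum \<Rightarrow> 'e list \<Rightarrow> 'e"
  where "datum_bracket s n g V brg \<Omega> zs =
    G_part s n brg \<Omega> (map (proj g V) zs) (map (proj V g) zs) +
    H_part s n \<Omega> (map (proj g V) zs) (map (proj V g) zs)"

(* The bracket brE on the whole space is the action-form unified product given by \<Omega>. *)
definition action_form_unified_product ::
  "('k::field_char_0 \<Rightarrow> 'e::ab_group_add \<Rightarrow> 'e) \<Rightarrow> nat \<Rightarrow> 'e set \<Rightarrow> 'e set \<Rightarrow>
    ('e list \<Rightarrow> 'e) \<Rightarrow> 'e action_datum \<Rightarrow> ('e list \<Rightarrow> 'e) \<Rightarrow> bool"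
  where "action_form_unified_product s n g V brg \<Omega> brE \<longleftrightarrow>
    extreme_action_datum s n g V \<Omega> \<and>
    n_lie_bracket s n UNIV (datum_bracket s n g V brg \<Omega>) \<and>
    (\<forall>zs\<in>nlists n UNIV. brE zs = datum_bracket s n g V brg \<Omega> zs)"

definition compatibility_identities ::
  "('k::field_char_0 \<Rightarrow> 'e::ab_group_add \<Rightarrow> 'e) \<Rightarrow> nat \<Rightarrow> 'e set \<Rightarrow> 'e set \<Rightarrow>
    ('e list \<Rightarrow> 'e) \<Rightarrow> 'e action_datum \<Rightarrow> bool"
  where "compatibility_identities s n g V brg \<Omega> \<longleftrightarrow>
    (let G = G_part s n brg \<Omega>; H = H_part s n \<Omega> in
      \<forall>xs\<in>nlists (n - 1) g. \<forall>us\<in>nlists (n - 1) V. \<forall>ys\<in>nlists n g. \<forall>vs\<in>nlists n V.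
        \<forall>F\<in>{G, H}.
          F (xs @ [G ys vs]) (us @ [H ys vs]) =
          (\<Sum>i<n. F (ys[i := G (xs @ [ys ! i]) (us @ [vs ! i])])
                    (vs[i := H (xs @ [ys ! i]) (us @ [vs ! i])])))"

(* For n = 2 the fields theta_V and rho_V describe the same component of brE, and so do
   rho_g and theta_g.  G_part and H_part then count each mixed component twice, and
   datum_bracket of this datum differs from brE unless brE vanishes on g x V. *)
definition induced_datum ::
  "'e::ab_group_add set \<Rightarrow> 'e set \<Rightarrow> ('e list \<Rightarrow> 'e) \<Rightarrow> 'e action_datum"
  where "induced_datum g V brE = \<lparr>
    rho_g = (\<lambda>xs u. proj V g (brE (xs @ [u]))),
    rho_V = (\<lambda>us x. proj g V (brE (us @ [x]))),
    theta_V = (\<lambda>u xs. proj g V (brE (u # xs))),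
    theta_g = (\<lambda>x us. proj V g (brE (us @ [x]))),
    omega = (\<lambda>us. proj g V (brE us)),
    curly = (\<lambda>us. proj V g (brE us))\<rparr>"

end

theory Submission
  imports Defs "HOL-Library.Multiset"
begin

text \<open>
  An alternating multilinear bracket \<open>f\<close> on \<open>g \<oplus> V\<close> is a sum of values on tuples whose
  entries all lie in one of the two summands: expanding every entry \<open>x + u\<close> gives one term for
  each set \<open>A\<close> of positions that receive the \<open>V\<close>-component. Up to sign such a term depends only
  on the multiset of its entries, so \<open>V\<close>-entries may be moved in front of \<open>g\<close>-entries, and
  extremeness kills every term with \<open>2 \<le> card A \<le> n - 2\<close>. The surviving terms have
  \<open>card A\<close> in \<open>{0, 1, n - 1, n}\<close>; moving their single exceptional entry to the first or last
  place produces the signs \<open>(-1)\<^sup>i\<close> and \<open>(-1)\<^bsup>n-1-i\<^esup>\<close>, and splitting each value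
  into its two projections gives the summands of \<open>G\<close> and \<open>H\<close>
  (lemmas \<open>alt_expand_extreme\<close> and \<open>reduced_datum_bracket\<close>).

  The case \<open>n = 2\<close> needs a modified datum. There \<open>1 = n - 1\<close>, so the sets of size \<open>1\<close> and of
  size \<open>n - 1\<close> coincide and the induced datum would count each mixed value twice. Dropping
  \<open>\<rho>\<^sub>V\<close> and \<open>\<vartheta>\<^sub>g\<close> from it restores the single count.

  For the converse, each of the four sums in \<open>G\<close> and \<open>H\<close> is a shuffle product of a single
  vector with an alternating tuple. Such a sum is alternating, because on a tuple with two equal
  entries only the two terms that single out one of these entries survive, and they differ by the
  sign of a cycle (lemma \<open>alt_insertion\<close>). The value of the new bracket has projections \<open>G\<close> and
  \<open>H\<close>, so the compatibility identities are the two components of the fundamental identity. On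
  tuples from \<open>g\<close>, and on tuples with at least two entries from each summand, zero components
  annihilate all summands of \<open>G\<close> and \<open>H\<close> except possibly the bracket of \<open>g\<close>.
\<close>

section \<open>Tuples with an entry omitted\<close>

(* Once tuple sets are unfolded, the premises of these rules reduce to their conclusions,
   so as rewrite rules they would loop. *)
declare nlistsE_length [simp del] nlistsE_set [simp del]

lemma length_omit: "i < length xs \<Longrightarrow> length (omit i xs) = length xs - 1"
  by (auto simp: omit_def)

text \<open>Omitting position \<open>i\<close> shifts every later position down by one.\<close>

lemma nth_omit:
  "\<lbrakk>i < length xs; j < length xs; j \<noteq> i\<rbrakk> \<Longrightarrow> omit i xs ! (if j < i then j else j - 1) = xs ! j"
  by (auto simp: omit_def nth_append min_def)

lemma omit_update:
  assumes "i < length xs" "j < length xs" "j \<noteq> i"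
  shows "omit i (xs[j := a]) = (omit i xs)[(if j < i then j else j - 1) := a]"
proof (cases "j < i")
  case True
  then show ?thesis using assms by (simp add: omit_def list_update_append take_update_swap)
next
  case False
  then have "i < j" using assms by simp
  then show ?thesis using assms
    by (auto simp: omit_def list_update_append drop_update_swap min_def)
qed

lemma omit_update_same: "omit i (xs[i := a]) = omit i xs"
  by (simp add: omit_def)

lemma omit_in_nlists:
  assumes "xs \<in> nlists n S" "i < n" shows "omit i xs \<in> nlists (n - 1) S"
proof (rule nlistsI)
  show "length (omit i xs) = n - 1" using assms by (simp add: length_omit nlistsE_length)
  have "set (omit i xs) \<subseteq> set xs"
    by (auto simp: omit_def dest: in_set_takeD in_set_dropD)
  then show "set (omit i xs) \<subseteq> S" using nlistsE_set[OF assms(1)] by simp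
qed

lemma repeated_in_omit:
  assumes "i < length xs" "a < length xs" "b < length xs" "a \<noteq> b" "xs ! a = c" "xs ! b = c"
  shows "c \<in> set (omit i xs)"
proof -
  obtain d where d: "d < length xs" "d \<noteq> i" "xs ! d = c" using assms by metis
  have "(if d < i then d else d - 1) < length (omit i xs)"
    using d assms(1) by (auto simp: length_omit)
  then show ?thesis using nth_omit[OF assms(1) d(1,2)] d(3) by (metis nth_mem)
qed

lemma omit_map: "omit i (map f xs) = map f (omit i xs)"
  by (simp add: omit_def take_map drop_map)

lemma update_eq_omit:
  "i < length xs \<Longrightarrow> xs[i := a] = take i xs @ a # drop (Suc i) xs"
  by (rule upd_conv_take_nth_drop)

section \<open>Linear and alternating multilinear maps\<close>

locale char0_vector_space = vector_space s
  for s :: "'k::field_char_0 \<Rightarrow> 'e::ab_group_add \<Rightarrow> 'e"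
begin

abbreviation lin where "lin \<equiv> linear_between s"
abbreviation alt where "alt \<equiv> alternating_multilinear s"

lemma lin_add: "\<lbrakk>lin S T f; a \<in> S; b \<in> S\<rbrakk> \<Longrightarrow> f (a + b) = f a + f b"
  by (simp add: linear_between_def)

lemma lin_in: "\<lbrakk>lin S T f; a \<in> S\<rbrakk> \<Longrightarrow> f a \<in> T"
  by (simp add: linear_between_def)

lemma lin_scale: "\<lbrakk>lin S T f; a \<in> S\<rbrakk> \<Longrightarrow> f (s c a) = s c (f a)"
  by (simp add: linear_between_def)

lemma lin_zero: "\<lbrakk>lin S T f; 0 \<in> S\<rbrakk> \<Longrightarrow> f 0 = 0"
  using lin_add[of S T f 0 0] by simp

lemma lin_comp: "\<lbrakk>lin S T f; lin T U h\<rbrakk> \<Longrightarrow> lin S U (\<lambda>a. h (f a))"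
  by (simp add: linear_between_def)

lemma lin_plus: "\<lbrakk>lin S T f; lin S T h; subspace T\<rbrakk> \<Longrightarrow> lin S T (\<lambda>a. f a + h a)"
  by (auto simp: linear_between_def subspace_add scale_right_distrib add_ac)

lemma lin_scaled: "\<lbrakk>lin S T f; subspace T\<rbrakk> \<Longrightarrow> lin S T (\<lambda>a. s c (f a))"
  by (auto simp: linear_between_def subspace_scale scale_right_distrib scale_left_commute)

lemma lin_zero_map: "subspace T \<Longrightarrow> lin S T (\<lambda>a. 0)"
  by (simp add: linear_between_def subspace_0)

lemma lin_sum:
  "\<lbrakk>finite I; \<And>i. i \<in> I \<Longrightarrow> lin S T (f i); subspace T\<rbrakk> \<Longrightarrow> lin S T (\<lambda>a. \<Sum>i\<in>I. f i a)"
proof (induction I rule: finite_induct)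
  case empty
  then show ?case by (simp add: lin_zero_map)
next
  case (insert i I)
  have "lin S T (\<lambda>a. f i a + (\<Sum>i\<in>I. f i a))"
    by (rule lin_plus) (use insert in auto)
  then show ?case using insert by simp
qed

lemma altI:
  assumes "\<And>xs i. \<lbrakk>xs \<in> nlists k S; i < k\<rbrakk> \<Longrightarrow> lin S T (\<lambda>a. f (xs[i := a]))"
    and "\<And>xs i j. \<lbrakk>xs \<in> nlists k S; i < j; j < k; xs ! i = xs ! j\<rbrakk> \<Longrightarrow> f xs = 0"
  shows "alt k S T f"
  using assms by (auto simp: alternating_multilinear_def)

lemma alt_lin: "\<lbrakk>alt k S T f; xs \<in> nlists k S; i < k\<rbrakk> \<Longrightarrow> lin S T (\<lambda>a. f (xs[i := a]))"
  by (simp add: alternating_multilinear_def)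

lemma alt_repeat:
  "\<lbrakk>alt k S T f; xs \<in> nlists k S; i < k; j < k; i \<noteq> j; xs ! i = xs ! j\<rbrakk> \<Longrightarrow> f xs = 0"
  unfolding alternating_multilinear_def by (metis nat_neq_iff)

lemma alt_in: "\<lbrakk>alt k S T f; xs \<in> nlists k S; 0 < k\<rbrakk> \<Longrightarrow> f xs \<in> T"
  using lin_in[OF alt_lin[of k S T f xs 0], of "xs ! 0"] nlistsE_nth_in[of xs k S 0] by simp

lemma alt_zero_entry:
  assumes f: "alt k S T f" and xs: "xs \<in> nlists k S" and z: "0 \<in> set xs"
  shows "f xs = 0"
proof -
  obtain i where i: "i < k" "xs ! i = 0"
    using z xs by (metis in_set_conv_nth nlistsE_length)
  have "0 \<in> S" using z nlistsE_set[OF xs] by blast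
  then show ?thesis
    using lin_zero[OF alt_lin[OF f xs i(1)]] i(2) by (metis list_update_id)
qed

lemma alt_mono: "\<lbrakk>alt k S T f; S' \<subseteq> S\<rbrakk> \<Longrightarrow> alt k S' T f"
  unfolding alternating_multilinear_def linear_between_def nlists_def by blast

lemma alt_target: "\<lbrakk>alt k S T f; T \<subseteq> T'\<rbrakk> \<Longrightarrow> alt k S T' f"
  unfolding alternating_multilinear_def linear_between_def by blast

lemma alt_comp:
  assumes "alt k S T f" "lin T U h" "0 \<in> T"
  shows "alt k S U (\<lambda>xs. h (f xs))"
proof (rule altI)
  fix xs i assume "xs \<in> nlists k S" "i < k"
  then show "lin S U (\<lambda>a. h (f (xs[i := a])))" by (rule lin_comp[OF alt_lin[OF assms(1)] assms(2)])
next
  fix xs i j assume "xs \<in> nlists k S" "i < j" "j < k" "xs ! i = xs ! j"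
  then have "f xs = 0" using alt_repeat[OF assms(1), of xs i j] by simp
  then show "h (f xs) = 0" using lin_zero[OF assms(2,3)] by simp
qed

lemma alt_pullback:
  assumes f: "alt k S T f" and h: "lin R S h"
  shows "alt k R T (\<lambda>xs. f (map h xs))"
proof -
  have m: "map h xs \<in> nlists k S" if "xs \<in> nlists k R" for xs
    using that lin_in[OF h] by (auto simp: nlists_def)
  show ?thesis
  proof (rule altI)
    fix xs i assume xs: "xs \<in> nlists k R" "i < k"
    show "lin R T (\<lambda>a. f (map h (xs[i := a])))"
      using lin_comp[OF h alt_lin[OF f m[OF xs(1)] xs(2)]] by (simp add: map_update)
  next
    fix xs i j assume xs: "xs \<in> nlists k R" "i < j" "j < k" "xs ! i = xs ! j"
    then show "f (map h xs) = 0"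
      using alt_repeat[OF f m[OF xs(1)], of i j] by (auto simp: nlists_def)
  qed
qed

lemma alt_plus:
  assumes "alt k S T f" "alt k S T h" "subspace T"
  shows "alt k S T (\<lambda>xs. f xs + h xs)"
proof (rule altI)
  fix xs i j assume "xs \<in> nlists k S" "i < j" "j < k" "xs ! i = xs ! j"
  then show "f xs + h xs = 0"
    using alt_repeat[OF assms(1), of xs i j] alt_repeat[OF assms(2), of xs i j] by simp
qed (rule lin_plus[OF alt_lin[OF assms(1)] alt_lin[OF assms(2)] assms(3)])

lemma alt_scaled:
  assumes "alt k S T f" "subspace T"
  shows "alt k S T (\<lambda>xs. s c (f xs))"
proof (rule altI)
  fix xs i j assume "xs \<in> nlists k S" "i < j" "j < k" "xs ! i = xs ! j"
  then show "s c (f xs) = 0" using alt_repeat[OF assms(1), of xs i j] by simp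
qed (rule lin_scaled[OF alt_lin[OF assms(1)] assms(2)])

lemma alt_zero_map: "subspace T \<Longrightarrow> alt k S T (\<lambda>xs. 0)"
  by (rule altI) (auto intro: lin_zero_map)

lemma alt_cong:
  assumes "alt k UNIV T f" "\<And>xs. xs \<in> nlists k UNIV \<Longrightarrow> f' xs = f xs"
  shows "alt k UNIV T f'"
  using assms by (auto simp: alternating_multilinear_def nlists_def)

lemma alt_fix_last:
  assumes f: "alt (Suc k) S T f" and u: "u \<in> S"
  shows "alt k S T (\<lambda>xs. f (xs @ [u]))"
proof -
  have m: "xs @ [u] \<in> nlists (Suc k) S" if "xs \<in> nlists k S" for xs
    using that u by (auto simp: nlists_def)
  show ?thesis
  proof (rule altI)
    fix xs i assume xs: "xs \<in> nlists k S" "i < k"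
    then show "lin S T (\<lambda>a. f (xs[i := a] @ [u]))"
      using alt_lin[OF f m[OF xs(1)], of i] by (simp add: list_update_append nlistsE_length)
  next
    fix xs i j assume xs: "xs \<in> nlists k S" "i < j" "j < k" "xs ! i = xs ! j"
    then show "f (xs @ [u]) = 0"
      using alt_repeat[OF f m[OF xs(1)], of i j] nlistsE_length[OF xs(1)]
      by (simp add: nth_append)
  qed
qed

lemma alt_fix_first:
  assumes f: "alt (Suc k) S T f" and u: "u \<in> S"
  shows "alt k S T (\<lambda>xs. f (u # xs))"
proof -
  have m: "u # xs \<in> nlists (Suc k) S" if "xs \<in> nlists k S" for xs
    using that u by (auto simp: nlists_def)
  show ?thesis
  proof (rule altI)
    fix xs i assume xs: "xs \<in> nlists k S" "i < k"
    then show "lin S T (\<lambda>a. f (u # xs[i := a]))"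
      using alt_lin[OF f m[OF xs(1)], of "Suc i"] by simp
  next
    fix xs i j assume xs: "xs \<in> nlists k S" "i < j" "j < k" "xs ! i = xs ! j"
    then show "f (u # xs) = 0"
      using alt_repeat[OF f m[OF xs(1)], of "Suc i" "Suc j"] by simp
  qed
qed

lemma alt_lin_last:
  assumes f: "alt (Suc k) S T f" and xs: "xs \<in> nlists k S"
  shows "lin S T (\<lambda>u. f (xs @ [u]))"
proof (cases "S = {}")
  case False
  then obtain b where b: "b \<in> S" by blast
  have "xs @ [b] \<in> nlists (Suc k) S" using xs b by (auto simp: nlists_def)
  from alt_lin[OF f this, of k] nlistsE_length[OF xs] show ?thesis
    by (simp add: list_update_append)
qed (simp add: linear_between_def)

lemma alt_lin_first:
  assumes f: "alt (Suc k) S T f" and xs: "xs \<in> nlists k S"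
  shows "lin S T (\<lambda>u. f (u # xs))"
proof (cases "S = {}")
  case False
  then obtain b where b: "b \<in> S" by blast
  have "b # xs \<in> nlists (Suc k) S" using xs b by (auto simp: nlists_def)
  from alt_lin[OF f this, of 0] show ?thesis by simp
qed (simp add: linear_between_def)

lemma lin_mono: "\<lbrakk>lin S T f; S' \<subseteq> S\<rbrakk> \<Longrightarrow> lin S' T f"
  unfolding linear_between_def by blast

section \<open>Permuting the entries\<close>

lemma alt_swap_adjacent:
  assumes f: "alt k S T f" and S: "subspace S" and xs: "ps @ a # b # rs \<in> nlists k S"
  shows "f (ps @ b # a # rs) = - f (ps @ a # b # rs)"
proof -
  let ?l = "length ps"
  let ?F = "\<lambda>x y. f (ps @ x # y # rs)"
  have ab: "a \<in> S" "b \<in> S" and l: "?l < k" "Suc ?l < k" using xs by (auto simp: nlists_def)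
  have in_S: "ps @ x # y # rs \<in> nlists k S" if "x \<in> S" "y \<in> S" for x y
    using xs that by (auto simp: nlists_def)
  have add1: "?F (x + x') y = ?F x y + ?F x' y" if "x \<in> S" "x' \<in> S" "y \<in> S" for x x' y
    using lin_add[OF alt_lin[OF f in_S[OF that(1,3)] l(1)] that(1,2)] by simp
  have add2: "?F x (y + y') = ?F x y + ?F x y'" if "x \<in> S" "y \<in> S" "y' \<in> S" for x y y'
    using lin_add[OF alt_lin[OF f in_S[OF that(1,2)] l(2)] that(2,3)] by (simp add: list_update_append)
  have diag: "?F x x = 0" if "x \<in> S" for x
    using alt_repeat[OF f in_S[OF that that] l] by (simp add: nth_append)
  (* Polarization: expand the vanishing diagonal value at a + b. *)
  have "?F (a + b) (a + b) = ?F a b + ?F b a"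
    using ab S by (simp add: add1 add2 diag[OF ab(1)] diag[OF ab(2)] subspace_add)
  then have "?F a b + ?F b a = 0" by (simp only: diag[OF subspace_add[OF S ab]])
  then show ?thesis by (metis add.commute eq_neg_iff_add_eq_0)
qed

lemma alt_move:
  assumes f: "alt k S T f" and S: "subspace S" and xs: "ps @ a # qs @ rs \<in> nlists k S"
  shows "f (ps @ qs @ a # rs) = s ((- 1) ^ length qs) (f (ps @ a # qs @ rs))"
  using xs
proof (induction qs arbitrary: ps)
  case Nil
  show ?case by simp
next
  case (Cons b qs)
  have *: "(ps @ [b]) @ a # qs @ rs \<in> nlists k S" using Cons.prems by (auto simp: nlists_def)
  have "f (ps @ (b # qs) @ a # rs) = s ((- 1) ^ length qs) (f (ps @ b # a # qs @ rs))"
    using Cons.IH[OF *] by simp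
  also have "f (ps @ b # a # qs @ rs) = - f (ps @ a # b # qs @ rs)"
    using alt_swap_adjacent[OF f S] Cons.prems by simp
  finally show ?case by simp
qed

lemma sign_self_inverse: "s ((- 1) ^ i) (s ((- 1) ^ i) a) = a"
  by (simp flip: power_add mult_2)

text \<open>
  An entry at position \<open>i\<close> has \<open>i\<close> entries before it and \<open>k - 1 - i\<close> after it; these two
  counts are the exponents of the signs in \<open>G\<close> and \<open>H\<close>.
\<close>

lemma alt_entry_to_front:
  assumes f: "alt k S T f" and S: "subspace S" and xs: "xs \<in> nlists k S" and i: "i < k"
    and a: "a \<in> S"
  shows "f (xs[i := a]) = s ((- 1) ^ i) (f (a # omit i xs))"
proof -
  have "[] @ a # take i xs @ drop (Suc i) xs \<in> nlists k S"
    using xs i a by (auto simp: nlists_def dest: in_set_takeD in_set_dropD)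
  from alt_move[OF f S this] show ?thesis
    using xs i by (simp add: nlists_def update_eq_omit omit_def)
qed

lemma alt_entry_to_back:
  assumes f: "alt k S T f" and S: "subspace S" and xs: "xs \<in> nlists k S" and i: "i < k"
    and a: "a \<in> S"
  shows "f (xs[i := a]) = s ((- 1) ^ (k - Suc i)) (f (omit i xs @ [a]))"
proof -
  have "take i xs @ a # drop (Suc i) xs @ [] \<in> nlists k S"
    using xs i a by (auto simp: nlists_def dest: in_set_takeD in_set_dropD)
  from alt_move[OF f S this]
  have "f (omit i xs @ [a]) = s ((- 1) ^ (k - Suc i)) (f (xs[i := a]))"
    using xs i by (simp add: nlists_def update_eq_omit omit_def)
  then show ?thesis by (simp only: sign_self_inverse)
qed

text \<open>
  The sign of a permutation is irrelevant for vanishing. The prefix \<open>ps\<close> collects the entries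
  that are already in place, which is what the induction on \<open>xs\<close> needs.
\<close>

lemma alt_permute_zero:
  assumes f: "alt k S T f" and S: "subspace S"
    and "ps @ xs \<in> nlists k S" "mset xs = mset ys" "f (ps @ xs) = 0"
  shows "f (ps @ ys) = 0"
  using assms(3-)
proof (induction xs arbitrary: ps ys)
  case Nil
  then have "ys = []" by simp
  with Nil show ?case by simp
next
  case (Cons a xs)
  have "a \<in> set ys" using Cons.prems(2) by (metis list.set_intros(1) set_mset_mset)
  then obtain y1 y2 where ys: "ys = y1 @ a # y2" by (meson split_list)
  have m: "mset xs = mset (y1 @ y2)" using Cons.prems(2) ys by simp
  have st: "set xs = set (y1 @ y2)" using m by (metis set_mset_mset)
  have ln: "length xs = length (y1 @ y2)" using m by (metis size_mset)
  have "f ((ps @ [a]) @ y1 @ y2) = 0"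
    by (rule Cons.IH) (use Cons.prems m in auto)
  moreover have "ps @ a # y1 @ y2 \<in> nlists k S"
    using Cons.prems(1) st ln by (auto simp: nlists_def)
  ultimately show ?case using alt_move[OF f S, of ps a y1 y2] ys by simp
qed

section \<open>Expansion over a sum of two tuples\<close>

text \<open>
  One entry is expanded at a time: after \<open>m\<close> steps the terms are indexed by the sets of
  positions below \<open>m\<close> at which the second summand was chosen.
\<close>

lemma alt_expand:
  fixes x u :: "nat \<Rightarrow> 'e"
  assumes f: "alt n S T f" and S: "subspace S" and xu: "\<And>i. i < n \<Longrightarrow> x i \<in> S \<and> u i \<in> S"
  shows "f (map (\<lambda>i. x i + u i) [0..<n]) =
    (\<Sum>A\<in>Pow {..<n}. f (map (\<lambda>i. if i \<in> A then u i else x i) [0..<n]))"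
proof -
  define mix where "mix m A = map (\<lambda>i. if i < m then if i \<in> A then u i else x i else x i + u i) [0..<n]"
    for m A
  have in_S: "mix m A \<in> nlists n S" for m A
    using xu S by (auto simp: mix_def nlists_def subspace_add)
  have "f (map (\<lambda>i. x i + u i) [0..<n]) = (\<Sum>A\<in>Pow {..<m}. f (mix m A))" if "m \<le> n" for m
    using that
  proof (induction m)
    case 0
    show ?case by (simp add: mix_def)
  next
    case (Suc m)
    have split: "f (mix m A) = f (mix (Suc m) A) + f (mix (Suc m) (insert m A))"
      if A: "A \<in> Pow {..<m}" for A
    proof -
      have e: "mix m A = (mix m A)[m := x m + u m]" "mix (Suc m) A = (mix m A)[m := x m]"
        "mix (Suc m) (insert m A) = (mix m A)[m := u m]"
        using A Suc.prems by (auto simp: mix_def nth_list_update intro!: nth_equalityI)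
      show ?thesis
        using lin_add[OF alt_lin[OF f in_S[of m A], of m], of "x m" "u m"] xu[of m] Suc.prems
        by (metis e Suc_le_lessD)
    qed
    have inj: "inj_on (insert m) (Pow {..<m})"
    proof (rule inj_onI)
      fix A B assume "A \<in> Pow {..<m}" "B \<in> Pow {..<m}" "insert m A = insert m B"
      moreover from this have "m \<notin> A" "m \<notin> B" by auto
      ultimately show "A = B" by (simp add: insert_ident)
    qed
    have disj: "Pow {..<m} \<inter> insert m ` Pow {..<m} = {}" by auto
    have "f (map (\<lambda>i. x i + u i) [0..<n]) = (\<Sum>A\<in>Pow {..<m}. f (mix m A))"
      using Suc by simp
    also have "\<dots> = (\<Sum>A\<in>Pow {..<m}. f (mix (Suc m) A)) + (\<Sum>A\<in>Pow {..<m}. f (mix (Suc m) (insert m A)))"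
      by (simp add: split sum.distrib)
    also have "\<dots> = (\<Sum>A\<in>Pow {..<m} \<union> insert m ` Pow {..<m}. f (mix (Suc m) A))"
      by (subst sum.union_disjoint) (auto simp: sum.reindex[OF inj] disj)
    also have "Pow {..<m} \<union> insert m ` Pow {..<m} = Pow {..<Suc m}"
      by (simp add: lessThan_Suc Pow_insert)
    finally show ?case .
  qed
  moreover have "mix n = (\<lambda>A. map (\<lambda>i. if i \<in> A then u i else x i) [0..<n])"
    by (auto simp: mix_def)
  ultimately show ?thesis by (metis order_refl)
qed

text \<open>
  Extremeness speaks only of tuples that start with their \<open>V\<close>-entries; sorting the positions
  into those in \<open>A\<close> and those outside \<open>A\<close> transfers vanishing to every arrangement.
\<close>

lemma alt_two_types_zero:
  assumes f: "alt n UNIV T f" and A: "A \<subseteq> {..<n}"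
    and zero: "\<And>us xs. us \<in> nlists (card A) V \<Longrightarrow> xs \<in> nlists (n - card A) g \<Longrightarrow> f (us @ xs) = 0"
    and x: "\<And>i. i < n \<Longrightarrow> x i \<in> g" and u: "\<And>i. i < n \<Longrightarrow> u i \<in> V"
  shows "f (map (\<lambda>i. if i \<in> A then u i else x i) [0..<n]) = 0"
proof -
  let ?h = "\<lambda>i. if i \<in> A then u i else x i"
  let ?us = "map u (filter (\<lambda>i. i \<in> A) [0..<n])"
  let ?xs = "map x (filter (\<lambda>i. i \<notin> A) [0..<n])"
  have "{i. i < n \<and> i \<in> A} = A" using A by auto
  then have lenA: "length (filter (\<lambda>i. i \<in> A) [0..<n]) = card A"
    by (simp add: length_filter_conv_card cong: conj_cong)
  have lenB: "length (filter (\<lambda>i. i \<notin> A) [0..<n]) = n - card A"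
    using sum_length_filter_compl[of "\<lambda>i. i \<in> A" "[0..<n]"] lenA by simp
  have us: "?us \<in> nlists (card A) V" and xs: "?xs \<in> nlists (n - card A) g"
    using x u lenA lenB by (auto simp: nlists_def)
  have "card A \<le> n" using A card_mono[of "{..<n}" A] by simp
  then have in_U: "[] @ ?us @ ?xs \<in> nlists n UNIV" using lenA lenB by (simp add: nlists_def)
  have "?us = map ?h (filter (\<lambda>i. i \<in> A) [0..<n])" "?xs = map ?h (filter (\<lambda>i. i \<notin> A) [0..<n])"
    by auto
  then have "mset (?us @ ?xs) =
      image_mset ?h (filter_mset (\<lambda>i. i \<in> A) (mset [0..<n]) + filter_mset (\<lambda>i. i \<notin> A) (mset [0..<n]))"
    by (simp only: mset_append mset_map mset_filter image_mset_union)
  also have "\<dots> = mset (map ?h [0..<n])"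
    by (simp only: multiset_partition[symmetric] mset_map)
  finally show ?thesis
    using alt_permute_zero[OF f subspace_UNIV in_U, of "map ?h [0..<n]"] zero[OF us xs] by simp
qed

text \<open>
  For \<open>n = 2\<close> the complement of a single position is again a single position, so the sets of
  size \<open>n - 1\<close> are already accounted for by those of size \<open>1\<close>; hence the conditional.
\<close>

lemma alt_expand_extreme:
  assumes f: "alt n UNIV T f" and n: "2 \<le> n" and ex: "extreme n g V f"
    and xs: "xs \<in> nlists n g" and us: "us \<in> nlists n V"
  shows "f (map (\<lambda>i. xs ! i + us ! i) [0..<n]) = f xs + f us
    + (\<Sum>i<n. s ((- 1) ^ (n - Suc i)) (f (omit i xs @ [us ! i])))
    + (if n = 2 then 0 else \<Sum>i<n. s ((- 1) ^ (n - Suc i)) (f (omit i us @ [xs ! i])))"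
proof -
  let ?F = "\<lambda>A. f (map (\<lambda>i. if i \<in> A then us ! i else xs ! i) [0..<n])"
  let ?one = "(\<lambda>i. {i}) ` {..<n}"
  let ?co = "if n = 2 then {} else (\<lambda>i. {..<n} - {i}) ` {..<n}"
  have len: "length xs = n" "length us = n" using xs us by (auto simp: nlists_def)
  have in_U: "xs \<in> nlists n UNIV" "us \<in> nlists n UNIV" using len by (auto simp: nlists_def)
  have vanish: "?F A = 0" if "A \<in> Pow {..<n} - ({{}} \<union> {{..<n}} \<union> ?one \<union> ?co)" for A
  proof -
    have A: "A \<subseteq> {..<n}" "A \<noteq> {}" "A \<noteq> {..<n}" "A \<notin> ?one" "A \<notin> ?co" using that by auto
    have fin: "finite A" using A(1) finite_subset by blast
    have c0: "card A \<noteq> 0" using A(2) fin by simp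
    have c1: "card A \<noteq> 1" using A(1,4) by (auto simp: card_1_singleton_iff)
    have cn: "card ({..<n} - A) \<noteq> 0" using A(1,3) by auto
    have cn1: "card ({..<n} - A) \<noteq> 1"
    proof
      assume "card ({..<n} - A) = 1"
      then obtain i where i: "{..<n} - A = {i}" by (meson card_1_singletonE)
      then have eq: "A = {..<n} - {i}" "i < n" using A(1) by auto
      with A(5) have "n = 2" by (auto split: if_splits)
      then have "card A = 1" using eq by simp
      with c1 show False by simp
    qed
    have "card ({..<n} - A) = n - card A" using A(1) fin by (simp add: card_Diff_subset)
    then have k: "2 \<le> card A" "card A \<le> n - 2" using c0 c1 cn cn1 by auto
    show ?thesis
    proof (rule alt_two_types_zero[OF f A(1)])
      show "f (us @ xs) = 0" if "us \<in> nlists (card A) V" "xs \<in> nlists (n - card A) g" for us xs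
        using ex k that by (auto simp: extreme_def)
      show "xs ! i \<in> g" "us ! i \<in> V" if "i < n" for i
        using that xs us by (simp_all add: nlistsE_nth_in)
    qed
  qed
  have F_empty: "?F {} = f xs"
    using len(1) by (simp add: map_nth[of xs, unfolded len])
  have "map (\<lambda>i. if i \<in> {..<n} then us ! i else xs ! i) [0..<n] = us"
    using len(2) by (auto intro: nth_equalityI)
  then have F_full: "?F {..<n} = f us" by simp
  have F_one: "?F {i} = s ((- 1) ^ (n - Suc i)) (f (omit i xs @ [us ! i]))" if "i < n" for i
  proof -
    have "map (\<lambda>j. if j \<in> {i} then us ! j else xs ! j) [0..<n] = xs[i := us ! i]"
      using len by (auto intro!: nth_equalityI simp: nth_list_update)
    then show ?thesis using alt_entry_to_back[OF f subspace_UNIV in_U(1) that] by simp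
  qed
  have F_co: "?F ({..<n} - {i}) = s ((- 1) ^ (n - Suc i)) (f (omit i us @ [xs ! i]))" if "i < n" for i
  proof -
    have "map (\<lambda>j. if j \<in> {..<n} - {i} then us ! j else xs ! j) [0..<n] = us[i := xs ! i]"
      using len by (auto intro!: nth_equalityI simp: nth_list_update)
    then show ?thesis using alt_entry_to_back[OF f subspace_UNIV in_U(2) that] by simp
  qed
  have full_ne: "{..<n} \<noteq> {i}" for i
  proof
    assume "{..<n} = {i}"
    then have "card {..<n} = card {i}" by simp
    then show False using n by simp
  qed
  have co_ne: "{..<n} - {i} \<noteq> {j}" "{..<n} - {i} \<noteq> {}" if "i < n" "n \<noteq> 2" for i j
  proof -
    have "card ({..<n} - {i}) = n - 1" using that by simp
    moreover have "card {j} = 1" "card ({} :: nat set) = 0" by auto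
    moreover have "n - 1 \<noteq> 1" "n - 1 \<noteq> 0" using n that by auto
    ultimately show "{..<n} - {i} \<noteq> {j}" "{..<n} - {i} \<noteq> {}" by metis+
  qed
  have inj_co: "inj_on (\<lambda>i. {..<n} - {i}) {..<n}" by (auto simp: inj_on_def)
  have "f (map (\<lambda>i. xs ! i + us ! i) [0..<n]) = (\<Sum>A\<in>Pow {..<n}. ?F A)"
    by (rule alt_expand[OF f subspace_UNIV]) simp
  also have "\<dots> = (\<Sum>A\<in>{{}} \<union> {{..<n}} \<union> ?one \<union> ?co. ?F A)"
    using vanish by (intro sum.mono_neutral_right) auto
  also have "\<dots> = ?F {} + ?F {..<n} + (\<Sum>A\<in>?one. ?F A) + (\<Sum>A\<in>?co. ?F A)"
  proof -
    have "{..<n} - {i} \<notin> {{}} \<union> {{..<n}} \<union> ?one" if "i < n" "n \<noteq> 2" for i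
      using co_ne[OF that] that(1) by blast
    then have "({{}} \<union> {{..<n}} \<union> ?one) \<inter> ?co = {}" by (cases "n = 2") auto
    moreover have "({{}} \<union> {{..<n}}) \<inter> ?one = {}" using full_ne by auto
    moreover have "{..<n} \<noteq> {}" using n by (simp add: lessThan_empty_iff)
    then have "{{}} \<inter> {{..<n}} = {}" by blast
    ultimately show ?thesis by (simp add: sum.union_disjoint del: Un_insert_left Un_insert_right insert_disjoint disjoint_insert)
  qed
  also have "(\<Sum>A\<in>?one. ?F A) = (\<Sum>i<n. ?F {i})"
    by (subst sum.reindex) (auto simp: inj_on_def)
  also have "\<dots> = (\<Sum>i<n. s ((- 1) ^ (n - Suc i)) (f (omit i xs @ [us ! i])))"
    by (intro sum.cong refl F_one) simp
  also have "(\<Sum>A\<in>?co. ?F A) = (if n = 2 then 0 else \<Sum>i<n. ?F ({..<n} - {i}))"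
    by (simp add: sum.reindex[OF inj_co] del: Diff_iff)
  also have "\<dots> = (if n = 2 then 0 else \<Sum>i<n. s ((- 1) ^ (n - Suc i)) (f (omit i us @ [xs ! i])))"
    using F_co by simp
  finally show ?thesis unfolding F_empty F_full .
qed

section \<open>Singling out one entry of an alternating tuple\<close>

text \<open>
  If entries \<open>i < j\<close> of \<open>zs\<close> agree, every term that omits neither of them has a repeated
  entry. The two remaining terms evaluate \<open>\<theta>\<close> at the same vector and at tuples that differ by
  moving one entry past the \<open>j - i - 1\<close> entries in between, so they cancel.
\<close>

lemma alt_insertion:
  assumes lin: "\<And>xs. xs \<in> nlists m UNIV \<Longrightarrow> lin UNIV T (\<lambda>u. \<theta> u xs)"
    and alt: "\<And>u. alt m UNIV T (\<theta> u)" and T: "subspace T"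
  shows "alt (Suc m) UNIV T (\<lambda>zs. \<Sum>i<Suc m. s ((- 1) ^ i) (\<theta> (zs ! i) (omit i zs)))"
proof (rule altI)
  fix zs :: "'e list" and j assume zs: "zs \<in> nlists (Suc m) UNIV" and j: "j < Suc m"
  have "lin UNIV T (\<lambda>a. \<theta> (zs[j := a] ! i) (omit i (zs[j := a])))" if i: "i < Suc m" for i
  proof (cases "i = j")
    case True
    then show ?thesis
      using lin[of "omit j zs"] omit_in_nlists[OF zs j] zs j
      by (simp add: omit_update_same nlists_def)
  next
    case False
    have l: "(if j < i then j else j - 1) < m" using i j False by auto
    show ?thesis
      using alt_lin[OF alt, OF _ l, of "omit i zs" "zs ! i"] omit_in_nlists[OF zs i] zs i j False
      by (simp add: omit_update nlists_def)
  qed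
  then show "lin UNIV T (\<lambda>a. \<Sum>i<Suc m. s ((- 1) ^ i) (\<theta> (zs[j := a] ! i) (omit i (zs[j := a]))))"
    by (intro lin_sum[OF _ lin_scaled[OF _ T] T]) auto
next
  fix zs :: "'e list" and i j
  assume zs: "zs \<in> nlists (Suc m) UNIV" and ij: "i < j" "j < Suc m" and eq: "zs ! i = zs ! j"
  let ?t = "\<lambda>k. s ((- 1) ^ k) (\<theta> (zs ! k) (omit k zs))"
  have len: "length zs = Suc m" using zs by (simp add: nlists_def)
  define a ps qs rs where "a = zs ! i" and "ps = take i zs" and "qs = drop (Suc i) (take j zs)"
    and "rs = drop (Suc j) zs"
  have "take j zs = ps @ a # qs"
    using id_take_nth_drop[of i "take j zs"] ij len by (simp add: ps_def qs_def a_def min_def)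
  then have zs_eq: "zs = ps @ a # qs @ a # rs"
    using id_take_nth_drop[of j zs] ij len eq by (simp add: a_def rs_def)
  have lens: "length ps = i" "length qs = j - Suc i"
    using ij len by (auto simp: ps_def qs_def)
  have o: "omit i zs = ps @ qs @ a # rs"
    using lens by (subst zs_eq) (simp add: omit_def)
  have o': "omit j zs = ps @ a # qs @ rs"
  proof -
    have "j = length (ps @ a # qs)" using lens ij by simp
    then show ?thesis by (simp only: zs_eq omit_def) simp
  qed
  have zero: "?t k = 0" if k: "k < Suc m" "k \<noteq> i" "k \<noteq> j" for k
  proof -
    have "omit k zs \<in> nlists m UNIV" using omit_in_nlists[OF zs k(1)] by simp
    then have "\<theta> (zs ! k) (omit k zs) = 0"
      using nth_omit[of k zs i] nth_omit[of k zs j] ij k len eq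
      by (intro alt_repeat[OF alt, of "omit k zs" "if i < k then i else i - 1" "if j < k then j else j - 1"])
         auto
    then show ?thesis by simp
  qed
  have "(\<Sum>k<Suc m. ?t k) = (\<Sum>k\<in>{i, j}. ?t k)"
    using ij zero by (intro sum.mono_neutral_right) auto
  also have "\<dots> = ?t i + ?t j" using ij by simp
  also have "\<dots> = 0"
  proof -
    have "ps @ a # qs @ rs \<in> nlists m UNIV"
      using omit_in_nlists[OF zs, of j] ij o' by simp
    from alt_move[OF alt subspace_UNIV this, of a]
    have "?t i = s ((- 1) ^ (i + (j - Suc i))) (\<theta> a (omit j zs))"
      using lens by (simp add: o o' a_def power_add)
    moreover have "?t j = s ((- 1) ^ Suc (i + (j - Suc i))) (\<theta> a (omit j zs))"
      using ij eq by (simp add: a_def)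
    ultimately show ?thesis by simp
  qed
  finally show "(\<Sum>k<Suc m. ?t k) = 0" .
qed

lemma sign_from_right: "i < n \<Longrightarrow> (- 1) ^ (n - Suc i) = (- 1) ^ (n - 1) * (- 1 :: 'k) ^ i"
proof -
  assume "i < n"
  then have "n - 1 + i = (n - Suc i) + 2 * i" by simp
  then show ?thesis by (simp flip: power_add) (simp add: power_add power_mult)
qed

text \<open>
  The form in which the sums of \<open>G\<close> and \<open>H\<close> occur: the single vector and the tuple are
  components of \<open>zs\<close> along \<open>q\<close> and \<open>p\<close>. Both sign conventions differ by the constant factor
  \<open>(-1)\<^bsup>n-1\<^esup>\<close>.
\<close>

lemma alt_insertion_split:
  assumes lin: "\<And>xs. xs \<in> nlists (n - 1) S \<Longrightarrow> lin U T (\<lambda>u. \<theta> u xs)"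
    and alt: "\<And>u. u \<in> U \<Longrightarrow> alt (n - 1) S T (\<theta> u)"
    and T: "subspace T" and p: "lin UNIV S p" and q: "lin UNIV U q" and n: "0 < n"
  shows "alt n UNIV T
      (\<lambda>zs. \<Sum>i<n. s ((- 1) ^ i) (\<theta> (map q zs ! i) (omit i (map p zs))))" (is "alt n _ _ ?f")
    and "alt n UNIV T
      (\<lambda>zs. \<Sum>i<n. s ((- 1) ^ (n - Suc i)) (\<theta> (map q zs ! i) (omit i (map p zs))))" (is "alt n _ _ ?h")
proof -
  let ?\<theta> = "\<lambda>u xs. \<theta> (q u) (map p xs)"
  have n': "Suc (n - 1) = n" using n by simp
  have "alt (Suc (n - 1)) UNIV T (\<lambda>zs. \<Sum>i<Suc (n - 1). s ((- 1) ^ i) (?\<theta> (zs ! i) (omit i zs)))"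
  proof (rule alt_insertion)
    fix xs :: "'e list" assume "xs \<in> nlists (n - 1) UNIV"
    then have "map p xs \<in> nlists (n - 1) S" using lin_in[OF p] by (auto simp: nlists_def)
    then show "lin UNIV T (\<lambda>u. ?\<theta> u xs)" using lin_comp[OF q lin] by blast
  next
    fix u show "alt (n - 1) UNIV T (?\<theta> u)"
      using alt_pullback[OF alt p] lin_in[OF q] by blast
  qed (rule T)
  then have base: "alt n UNIV T (\<lambda>zs. \<Sum>i<n. s ((- 1) ^ i) (?\<theta> (zs ! i) (omit i zs)))"
    by (simp only: n')
  show "alt n UNIV T ?f"
    by (rule alt_cong[OF base]) (auto simp: nlists_def omit_map)
  show "alt n UNIV T ?h"
  proof (rule alt_cong[OF alt_scaled[OF base T, of "(- 1) ^ (n - 1)"]])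
    fix zs :: "'e list" assume zs: "zs \<in> nlists n UNIV"
    have "s ((- 1) ^ (n - Suc i)) (\<theta> (map q zs ! i) (omit i (map p zs))) =
        s ((- 1) ^ (n - 1)) (s ((- 1) ^ i) (?\<theta> (zs ! i) (omit i zs)))" if "i < n" for i
      using that zs by (simp only: sign_from_right[OF that]) (simp add: nlists_def omit_map)
    then show "?h zs = s ((- 1) ^ (n - 1)) (\<Sum>i<n. s ((- 1) ^ i) (?\<theta> (zs ! i) (omit i zs)))"
      by (simp add: scale_sum_right)
  qed
qed

section \<open>Projections of a direct decomposition\<close>

lemma decomposition_commute: "direct_decomposition s A B \<Longrightarrow> direct_decomposition s B A"
  unfolding direct_decomposition_def by (metis add.commute inf_commute)

lemma proj_eqI:
  assumes D: "direct_decomposition s A B" and a: "a \<in> A" "z - a \<in> B"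
  shows "proj A B z = a"
  unfolding proj_def
proof (rule the_equality)
  fix a' assume a': "a' \<in> A \<and> z - a' \<in> B"
  have "a' - a \<in> A" using D a a' by (auto simp: direct_decomposition_def subspace_diff)
  moreover have "(z - a) - (z - a') \<in> B"
    using D a a' unfolding direct_decomposition_def by (metis subspace_diff)
  ultimately have "a' - a \<in> A \<inter> B" by simp
  then have "a' - a = 0" using D unfolding direct_decomposition_def by blast
  then show "a' = a" by simp
qed (use a in simp)

lemma proj_add:
  assumes D: "direct_decomposition s A B" and "a \<in> A" "b \<in> B"
  shows "proj A B (a + b) = a" "proj B A (a + b) = b"
  using assms proj_eqI[OF D, of a "a + b"] proj_eqI[OF decomposition_commute[OF D], of b "a + b"]
  by auto

lemma proj_parts:
  assumes D: "direct_decomposition s A B"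
  shows "proj A B z \<in> A" "proj A B z + proj B A z = z"
proof -
  obtain a b where "a \<in> A" "b \<in> B" "z = a + b"
    using D unfolding direct_decomposition_def by blast
  then show "proj A B z \<in> A" "proj A B z + proj B A z = z" using proj_add[OF D] by auto
qed

lemma lin_proj:
  assumes D: "direct_decomposition s A B"
  shows "lin UNIV A (proj A B)"
proof -
  have A: "subspace A" and B: "subspace B" using D by (auto simp: direct_decomposition_def)
  note D' = decomposition_commute[OF D]
  have "proj A B (y + z) = proj A B y + proj A B z" for y z
  proof -
    have "y + z = (proj A B y + proj A B z) + (proj B A y + proj B A z)"
      using proj_parts(2)[OF D, of y] proj_parts(2)[OF D, of z] by (metis add.assoc add.left_commute)
    then show ?thesis
      using proj_add(1)[OF D] proj_parts(1)[OF D] proj_parts(1)[OF D'] A B by (metis subspace_add)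
  qed
  moreover have "proj A B (s c z) = s c (proj A B z)" for c z
  proof -
    have "s c z = s c (proj A B z) + s c (proj B A z)"
      using proj_parts(2)[OF D, of z] by (metis scale_right_distrib)
    then show ?thesis
      using proj_add(1)[OF D] proj_parts(1)[OF D] proj_parts(1)[OF D'] A B by (metis subspace_scale)
  qed
  ultimately show ?thesis using proj_parts(1)[OF D] by (simp add: linear_between_def)
qed

lemma proj_on_summand:
  assumes D: "direct_decomposition s A B" and xs: "xs \<in> nlists k A"
  shows "map (proj A B) xs = xs" "map (proj B A) xs = replicate k 0"
proof -
  have "0 \<in> B" using D by (auto simp: direct_decomposition_def subspace_0)
  then have "proj A B x = x" "proj B A x = 0" if "x \<in> A" for x
    using proj_add[OF D that, of 0] by auto
  then show "map (proj A B) xs = xs" "map (proj B A) xs = replicate k 0"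
    using xs by (auto simp: nlists_def subset_iff intro: map_idI map_replicate_const[THEN subst]
        intro!: replicate_eqI)
qed

lemma map_proj_in:
  assumes "direct_decomposition s A B" "zs \<in> nlists k UNIV"
  shows "map (proj A B) zs \<in> nlists k A"
  using assms proj_parts(1) by (auto simp: nlists_def)

section \<open>From a datum to a bracket\<close>

lemma extreme_action_datumD:
  assumes "extreme_action_datum s n g V \<Omega>"
  shows "xs \<in> nlists (n - 1) g \<Longrightarrow> lin V V (rho_g \<Omega> xs)"
    and "u \<in> V \<Longrightarrow> alt (n - 1) g V (\<lambda>xs. rho_g \<Omega> xs u)"
    and "us \<in> nlists (n - 1) V \<Longrightarrow> lin g g (rho_V \<Omega> us)"
    and "x \<in> g \<Longrightarrow> alt (n - 1) V g (\<lambda>us. rho_V \<Omega> us x)"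
    and "xs \<in> nlists (n - 1) g \<Longrightarrow> lin V g (\<lambda>u. theta_V \<Omega> u xs)"
    and "u \<in> V \<Longrightarrow> alt (n - 1) g g (theta_V \<Omega> u)"
    and "us \<in> nlists (n - 1) V \<Longrightarrow> lin g V (\<lambda>x. theta_g \<Omega> x us)"
    and "x \<in> g \<Longrightarrow> alt (n - 1) V V (theta_g \<Omega> x)"
    and "alt n V g (omega \<Omega>)"
    and "alt n V V (curly \<Omega>)"
  using assms by (simp_all add: extreme_action_datum_def)

lemma alt_G_part:
  assumes D: "direct_decomposition s g V" and brg: "alt n g g brg" and n: "0 < n"
    and \<Omega>: "extreme_action_datum s n g V \<Omega>"
  shows "alt n UNIV g (\<lambda>zs. G_part s n brg \<Omega> (map (proj g V) zs) (map (proj V g) zs))"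
proof -
  note \<Omega>D = extreme_action_datumD[OF \<Omega>]
  note D' = decomposition_commute[OF D]
  have g: "subspace g" using D by (simp add: direct_decomposition_def)
  note pg = lin_proj[OF D] and pV = lin_proj[OF D']
  have "alt n UNIV g (\<lambda>zs. \<Sum>i<n. s ((- 1) ^ i)
      (theta_V \<Omega> (map (proj V g) zs ! i) (omit i (map (proj g V) zs))))"
    by (rule alt_insertion_split(1)[OF \<Omega>D(5) \<Omega>D(6) g pg pV n])
  moreover have "alt n UNIV g (\<lambda>zs. \<Sum>i<n. s ((- 1) ^ (n - Suc i))
      (rho_V \<Omega> (omit i (map (proj V g) zs)) (map (proj g V) zs ! i)))"
    by (rule alt_insertion_split(2)[OF \<Omega>D(3) \<Omega>D(4) g pV pg n])
  ultimately show ?thesis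
    unfolding G_part_def
    by (intro alt_plus g alt_pullback[OF brg pg] alt_pullback[OF \<Omega>D(9) pV])
qed

lemma alt_H_part:
  assumes D: "direct_decomposition s g V" and n: "0 < n"
    and \<Omega>: "extreme_action_datum s n g V \<Omega>"
  shows "alt n UNIV V (\<lambda>zs. H_part s n \<Omega> (map (proj g V) zs) (map (proj V g) zs))"
proof -
  note \<Omega>D = extreme_action_datumD[OF \<Omega>]
  note D' = decomposition_commute[OF D]
  have V: "subspace V" using D by (simp add: direct_decomposition_def)
  note pg = lin_proj[OF D] and pV = lin_proj[OF D']
  have "alt n UNIV V (\<lambda>zs. \<Sum>i<n. s ((- 1) ^ (n - Suc i))
      (rho_g \<Omega> (omit i (map (proj g V) zs)) (map (proj V g) zs ! i)))"
    by (rule alt_insertion_split(2)[OF \<Omega>D(1) \<Omega>D(2) V pg pV n])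
  moreover have "alt n UNIV V (\<lambda>zs. \<Sum>i<n. s ((- 1) ^ (n - Suc i))
      (theta_g \<Omega> (map (proj g V) zs ! i) (omit i (map (proj V g) zs))))"
    by (rule alt_insertion_split(2)[OF \<Omega>D(7) \<Omega>D(8) V pV pg n])
  ultimately show ?thesis
    unfolding H_part_def
    by (intro alt_plus V alt_pullback[OF \<Omega>D(10) pV])
qed

text \<open>
  Projecting the fundamental identity to \<open>g\<close> and to \<open>V\<close> gives the compatibility identities
  for \<open>G\<close> and for \<open>H\<close>, since replacing an entry by a bracket value replaces its two components
  by the corresponding values of \<open>G\<close> and \<open>H\<close>.
\<close>

lemma datum_bracket_n_lie:
  assumes D: "direct_decomposition s g V" and brg: "alt n g g brg" and n: "0 < n"
    and \<Omega>: "extreme_action_datum s n g V \<Omega>"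
    and comp: "compatibility_identities s n g V brg \<Omega>"
  shows "n_lie_bracket s n UNIV (datum_bracket s n g V brg \<Omega>)"
proof -
  let ?pg = "map (proj g V)" and ?pV = "map (proj V g)"
  let ?G = "G_part s n brg \<Omega>" and ?H = "H_part s n \<Omega>"
  let ?br = "datum_bracket s n g V brg \<Omega>"
  note D' = decomposition_commute[OF D]
  have G: "alt n UNIV g (\<lambda>zs. ?G (?pg zs) (?pV zs))" by (rule alt_G_part[OF D brg n \<Omega>])
  have H: "alt n UNIV V (\<lambda>zs. ?H (?pg zs) (?pV zs))" by (rule alt_H_part[OF D n \<Omega>])
  have alt_br: "alt n UNIV UNIV ?br"
    unfolding datum_bracket_def
    by (rule alt_plus[OF alt_target[OF G] alt_target[OF H]]) auto
  have parts: "proj g V (?br zs) = ?G (?pg zs) (?pV zs)" "proj V g (?br zs) = ?H (?pg zs) (?pV zs)"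
    if "zs \<in> nlists n UNIV" for zs
    using proj_add[OF D alt_in[OF G that n] alt_in[OF H that n]] by (simp_all add: datum_bracket_def)
  have "?br (zs @ [?br ws]) = (\<Sum>i<n. ?br (ws[i := ?br (zs @ [ws ! i])]))"
    if zs: "zs \<in> nlists (n - 1) UNIV" and ws: "ws \<in> nlists n UNIV" for zs ws
  proof -
    let ?Gi = "\<lambda>i. ?G (?pg zs @ [?pg ws ! i]) (?pV zs @ [?pV ws ! i])"
    let ?Hi = "\<lambda>i. ?H (?pg zs @ [?pg ws ! i]) (?pV zs @ [?pV ws ! i])"
    have F: "F (?pg zs @ [?G (?pg ws) (?pV ws)]) (?pV zs @ [?H (?pg ws) (?pV ws)]) =
        (\<Sum>i<n. F ((?pg ws)[i := ?Gi i]) ((?pV ws)[i := ?Hi i]))" if "F \<in> {?G, ?H}" for F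
      using comp that map_proj_in[OF D zs] map_proj_in[OF D ws] map_proj_in[OF D' zs]
        map_proj_in[OF D' ws]
      unfolding compatibility_identities_def Let_def by blast
    have summand: "?br (ws[i := ?br (zs @ [ws ! i])]) =
        ?G ((?pg ws)[i := ?Gi i]) ((?pV ws)[i := ?Hi i]) +
        ?H ((?pg ws)[i := ?Gi i]) ((?pV ws)[i := ?Hi i])" if i: "i < n" for i
    proof -
      have "zs @ [ws ! i] \<in> nlists n UNIV" using zs n by (simp add: nlists_def)
      from parts[OF this]
      have "proj g V (?br (zs @ [ws ! i])) = ?Gi i" "proj V g (?br (zs @ [ws ! i])) = ?Hi i"
        using i ws by (simp_all add: nlists_def)
      then show ?thesis by (simp only: datum_bracket_def[of _ _ _ _ _ _ "ws[i := _]"] map_update)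
    qed
    have "?br (zs @ [?br ws]) =
        ?G (?pg zs @ [?G (?pg ws) (?pV ws)]) (?pV zs @ [?H (?pg ws) (?pV ws)]) +
        ?H (?pg zs @ [?G (?pg ws) (?pV ws)]) (?pV zs @ [?H (?pg ws) (?pV ws)])"
      using parts[OF ws] by (simp only: datum_bracket_def[of _ _ _ _ _ _ "zs @ _"] map_append list.map)
    also have "\<dots> = (\<Sum>i<n. ?br (ws[i := ?br (zs @ [ws ! i])]))"
      using F[of ?G] F[of ?H] summand by (simp add: sum.distrib)
    finally show ?thesis .
  qed
  with alt_br show ?thesis by (simp add: n_lie_bracket_def)
qed

text \<open>
  The \<open>V\<close>-components of a tuple from \<open>g\<close> are all zero. Because \<open>n \<ge> 2\<close>, a zero remains after
  one of them is omitted.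
\<close>

lemma datum_bracket_contains:
  assumes D: "direct_decomposition s g V" and n: "2 \<le> n"
    and \<Omega>: "extreme_action_datum s n g V \<Omega>"
  shows "contains_subalgebra n g brg (datum_bracket s n g V brg \<Omega>)"
  unfolding contains_subalgebra_def
proof
  fix xs assume xs: "xs \<in> nlists n g"
  note \<Omega>D = extreme_action_datumD[OF \<Omega>]
  let ?z = "replicate n (0 :: 'e)"
  have g0: "0 \<in> g" and V0: "0 \<in> V" using D by (auto simp: direct_decomposition_def subspace_0)
  have z: "?z \<in> nlists n V" using V0 by (simp add: nlists_replicateI)
  have xg: "xs ! i \<in> g" if "i < n" for i using xs that by (rule nlistsE_nth_in)
  have zero_in: "0 \<in> set ?z" using n by simp
  have omit_zero_in: "0 \<in> set (omit i ?z)" if "i < n" for i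
    using repeated_in_omit[of i ?z 0 1] that n by simp
  have "omega \<Omega> ?z = 0" "curly \<Omega> ?z = 0"
    using alt_zero_entry[OF \<Omega>D(9) z zero_in] alt_zero_entry[OF \<Omega>D(10) z zero_in] by auto
  moreover have "theta_V \<Omega> 0 (omit i xs) = 0" "rho_g \<Omega> (omit i xs) 0 = 0"
    "rho_V \<Omega> (omit i ?z) (xs ! i) = 0" "theta_g \<Omega> (xs ! i) (omit i ?z) = 0" if i: "i < n" for i
    using lin_zero[OF \<Omega>D(5)[OF omit_in_nlists[OF xs i]] V0]
      lin_zero[OF \<Omega>D(1)[OF omit_in_nlists[OF xs i]] V0]
      alt_zero_entry[OF \<Omega>D(4)[OF xg[OF i]] omit_in_nlists[OF z i] omit_zero_in[OF i]]
      alt_zero_entry[OF \<Omega>D(8)[OF xg[OF i]] omit_in_nlists[OF z i] omit_zero_in[OF i]]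
    by auto
  ultimately show "datum_bracket s n g V brg \<Omega> xs = brg xs"
    by (simp add: datum_bracket_def G_part_def H_part_def proj_on_summand[OF D xs])
qed

text \<open>
  The bound \<open>2 \<le> k\<close> gives two zeros among the \<open>g\<close>-components and \<open>k \<le> n - 2\<close> gives two among
  the \<open>V\<close>-components, so every tuple with one omitted entry still contains a zero.
\<close>

lemma datum_bracket_extreme:
  assumes D: "direct_decomposition s g V" and brg: "alt n g g brg"
    and \<Omega>: "extreme_action_datum s n g V \<Omega>"
  shows "extreme n g V (datum_bracket s n g V brg \<Omega>)"
  unfolding extreme_def
proof (intro allI impI ballI)
  fix k us xs assume k: "2 \<le> k \<and> k \<le> n - 2" and us: "us \<in> nlists k V" and xs: "xs \<in> nlists (n - k) g"
  note \<Omega>D = extreme_action_datumD[OF \<Omega>]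
  note D' = decomposition_commute[OF D]
  let ?X = "replicate k 0 @ xs" and ?U = "us @ replicate (n - k) 0"
  have "0 \<in> g" "0 \<in> V" using D by (auto simp: direct_decomposition_def subspace_0)
  then have X: "?X \<in> nlists n g" and U: "?U \<in> nlists n V"
    using us xs k by (auto simp: nlists_def)
  have len: "length us = k" "length xs = n - k" using us xs by (auto simp: nlists_def)
  have z: "0 \<in> set ?X" "0 \<in> set ?U" using k by auto
  have Xg: "?X ! i \<in> g" and UV: "?U ! i \<in> V" if "i < n" for i
    using that nlistsE_nth_in[OF X] nlistsE_nth_in[OF U] by auto
  have oX: "0 \<in> set (omit i ?X)" if "i < n" for i
    using repeated_in_omit[of i ?X 0 1] that k len by (simp add: nth_append)
  have oU: "0 \<in> set (omit i ?U)" if "i < n" for i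
  proof -
    have "Suc k < n" using k by linarith
    then show ?thesis
      using repeated_in_omit[of i ?U k "Suc k" 0] that len by (simp add: nth_append)
  qed
  have "brg ?X = 0" "omega \<Omega> ?U = 0" "curly \<Omega> ?U = 0"
    using alt_zero_entry[OF brg X z(1)] alt_zero_entry[OF \<Omega>D(9) U z(2)]
      alt_zero_entry[OF \<Omega>D(10) U z(2)] by auto
  moreover have "theta_V \<Omega> (?U ! i) (omit i ?X) = 0" "rho_g \<Omega> (omit i ?X) (?U ! i) = 0"
    "rho_V \<Omega> (omit i ?U) (?X ! i) = 0" "theta_g \<Omega> (?X ! i) (omit i ?U) = 0" if i: "i < n" for i
    using alt_zero_entry[OF \<Omega>D(6)[OF UV[OF i]] omit_in_nlists[OF X i] oX[OF i]]
      alt_zero_entry[OF \<Omega>D(2)[OF UV[OF i]] omit_in_nlists[OF X i] oX[OF i]]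
      alt_zero_entry[OF \<Omega>D(4)[OF Xg[OF i]] omit_in_nlists[OF U i] oU[OF i]]
      alt_zero_entry[OF \<Omega>D(8)[OF Xg[OF i]] omit_in_nlists[OF U i] oU[OF i]]
    by auto
  moreover have "map (proj g V) (us @ xs) = ?X" "map (proj V g) (us @ xs) = ?U"
    using proj_on_summand[OF D xs] proj_on_summand[OF D' us] by auto
  ultimately show "datum_bracket s n g V brg \<Omega> (us @ xs) = 0"
    by (simp add: datum_bracket_def G_part_def H_part_def)
qed

section \<open>From a bracket to a datum\<close>

lemma induced_datum_extreme:
  assumes D: "direct_decomposition s g V" and f: "alt n UNIV UNIV f" and n: "0 < n"
  shows "extreme_action_datum s n g V (induced_datum g V f)"
proof -
  note pg = lin_proj[OF D] and pV = lin_proj[OF decomposition_commute[OF D]]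
  have f': "alt (Suc (n - 1)) UNIV UNIV f" using f n by simp
  have U: "xs \<in> nlists k UNIV" if "xs \<in> nlists k S" for xs :: "'e list" and k S
    using that by (simp add: nlists_def)
  note last = lin_mono[OF lin_comp[OF alt_lin_last[OF f' U]] subset_UNIV]
  note first = lin_mono[OF lin_comp[OF alt_lin_first[OF f' U]] subset_UNIV]
  note fix_last = alt_mono[OF alt_comp[OF alt_fix_last[OF f' UNIV_I] _ UNIV_I] subset_UNIV]
  note fix_first = alt_mono[OF alt_comp[OF alt_fix_first[OF f' UNIV_I] _ UNIV_I] subset_UNIV]
  note all = alt_mono[OF alt_comp[OF f _ UNIV_I] subset_UNIV]
  show ?thesis
    unfolding extreme_action_datum_def induced_datum_def action_datum.simps
    using last[OF _ pV] last[OF _ pg] first[OF _ pg] fix_last[OF pV] fix_last[OF pg]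
      fix_first[OF pg] all[OF pg] all[OF pV]
    by (intro conjI ballI) assumption+
qed

text \<open>
  For \<open>n = 2\<close> the pairs \<open>\<vartheta>\<^sub>V, \<rho>\<^sub>V\<close> and \<open>\<rho>\<^sub>g, \<vartheta>\<^sub>g\<close> of the induced datum each
  describe one and the same component of the bracket, so one member of each pair is set to zero.
\<close>

definition reduced_datum :: "nat \<Rightarrow> 'e set \<Rightarrow> 'e set \<Rightarrow> ('e list \<Rightarrow> 'e) \<Rightarrow> 'e action_datum"
  where "reduced_datum n g V f =
    (if n = 2 then (induced_datum g V f)\<lparr>rho_V := \<lambda>us x. 0, theta_g := \<lambda>x us. 0\<rparr>
     else induced_datum g V f)"

lemma reduced_datum_extreme:
  assumes D: "direct_decomposition s g V" and f: "alt n UNIV UNIV f" and n: "0 < n"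
  shows "extreme_action_datum s n g V (reduced_datum n g V f)"
proof -
  have "subspace g" "subspace V" using D by (auto simp: direct_decomposition_def)
  then show ?thesis
    using induced_datum_extreme[OF assms]
    by (auto simp: reduced_datum_def extreme_action_datum_def lin_zero_map alt_zero_map)
qed

text \<open>
  Adding \<open>G\<close> and \<open>H\<close> joins the two projections of every term of the expansion. Only
  \<open>\<vartheta>\<^sub>V\<close> takes its single vector in first place; the equation \<open>front\<close> rewrites its sign
  and argument to the convention of the other terms.
\<close>

lemma reduced_datum_bracket:
  assumes D: "direct_decomposition s g V" and f: "alt n UNIV UNIV f" and n: "2 \<le> n"
    and sub: "contains_subalgebra n g brg f" and ex: "extreme n g V f"
    and zs: "zs \<in> nlists n UNIV"
  shows "f zs = datum_bracket s n g V brg (reduced_datum n g V f) zs"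
proof -
  let ?pg = "proj g V" and ?pV = "proj V g"
  note D' = decomposition_commute[OF D]
  define xs us where "xs = map ?pg zs" and "us = map ?pV zs"
  let ?sgn = "\<lambda>i. (- 1 :: 'k) ^ (n - Suc i)"
  let ?y = "\<lambda>i. f (omit i xs @ [us ! i])" and ?w = "\<lambda>i. f (omit i us @ [xs ! i])"
  have xs: "xs \<in> nlists n g" and us: "us \<in> nlists n V"
    unfolding xs_def us_def using zs by (auto intro: map_proj_in D D')
  have len: "length zs = n" using zs by (simp add: nlists_def)
  have xU: "xs \<in> nlists n UNIV" using len by (simp add: nlists_def xs_def)
  have zs_eq: "zs = map (\<lambda>i. xs ! i + us ! i) [0..<n]"
    using len by (auto intro!: nth_equalityI simp: xs_def us_def proj_parts(2)[OF D])
  have join: "?pg z + ?pV z = z" for z by (rule proj_parts(2)[OF D])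
  have sc: "?pg (s c z) = s c (?pg z)" for c z by (rule lin_scale[OF lin_proj[OF D] UNIV_I])
  have front: "s ((- 1) ^ i) (?pg (f (us ! i # omit i xs))) = s (?sgn i) (?pg (?y i))" if "i < n" for i
    using alt_entry_to_front[OF f subspace_UNIV xU that UNIV_I[of "us ! i"]]
      alt_entry_to_back[OF f subspace_UNIV xU that UNIV_I[of "us ! i"]]
    by (metis sc)
  have join_sum: "(\<Sum>i<n. s (?sgn i) (h i)) =
      (\<Sum>i<n. s (?sgn i) (?pg (h i))) + (\<Sum>i<n. s (?sgn i) (?pV (h i)))" for h
    by (simp add: join flip: sum.distrib scale_right_distrib)
  have G: "G_part s n brg (reduced_datum n g V f) xs us = f xs + ?pg (f us)
      + (\<Sum>i<n. s (?sgn i) (?pg (?y i)))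
      + (if n = 2 then 0 else \<Sum>i<n. s (?sgn i) (?pg (?w i)))"
    using sub xs
    by (simp add: G_part_def reduced_datum_def induced_datum_def contains_subalgebra_def front)
  have H: "H_part s n (reduced_datum n g V f) xs us = ?pV (f us)
      + (\<Sum>i<n. s (?sgn i) (?pV (?y i)))
      + (if n = 2 then 0 else \<Sum>i<n. s (?sgn i) (?pV (?w i)))"
    by (simp add: H_part_def reduced_datum_def induced_datum_def)
  have "f zs = f xs + f us + (\<Sum>i<n. s (?sgn i) (?y i))
      + (if n = 2 then 0 else \<Sum>i<n. s (?sgn i) (?w i))"
    by (subst zs_eq) (rule alt_expand_extreme[OF f n ex xs us])
  also have "\<dots> = G_part s n brg (reduced_datum n g V f) xs us + H_part s n (reduced_datum n g V f) xs us"
    unfolding G H join_sum[of ?y] join_sum[of ?w]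
    by (subst join[of "f us", symmetric]) (simp only: add_ac split: if_split, simp)
  finally show ?thesis by (simp add: datum_bracket_def xs_def us_def)
qed

lemma n_lie_bracket_cong:
  assumes f: "n_lie_bracket s n UNIV f" and n: "0 < n"
    and eq: "\<And>zs. zs \<in> nlists n UNIV \<Longrightarrow> f' zs = f zs"
  shows "n_lie_bracket s n UNIV f'"
proof -
  have "f' (zs @ [z]) = f (zs @ [z])" if "zs \<in> nlists (n - 1) UNIV" for zs z
    using that n by (intro eq) (simp add: nlists_def)
  moreover have "f' (ws[i := z]) = f (ws[i := z])" if "ws \<in> nlists n UNIV" for ws i z
    using that by (intro eq) (simp add: nlists_def)
  ultimately show ?thesis
    using f alt_cong[of n UNIV f f'] eq by (simp add: n_lie_bracket_def)
qed

lemma reduced_datum_product: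
  assumes D: "direct_decomposition s g V" and n: "2 \<le> n" and f: "n_lie_bracket s n UNIV f"
    and sub: "contains_subalgebra n g brg f" and ex: "extreme n g V f"
  shows "action_form_unified_product s n g V brg (reduced_datum n g V f) f"
proof -
  have alt: "alt n UNIV UNIV f" using f by (simp add: n_lie_bracket_def)
  have n0: "0 < n" using n by simp
  note eq = reduced_datum_bracket[OF D alt n sub ex]
  have "n_lie_bracket s n UNIV (datum_bracket s n g V brg (reduced_datum n g V f))"
    by (rule n_lie_bracket_cong[OF f n0]) (simp add: eq)
  then show ?thesis
    using reduced_datum_extreme[OF D alt n0] eq by (simp add: action_form_unified_product_def)
qed

end

theorem theorem4p2:
  fixes s :: "'k::field_char_0 \<Rightarrow> 'e::ab_group_add \<Rightarrow> 'e"
    and n :: nat and g V :: "'e set" and brg :: "'e list \<Rightarrow> 'e"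
  assumes "vector_space s"
    and "2 \<le> n"
    and "direct_decomposition s g V"
    and "n_lie_bracket s n g brg"
  shows "(\<forall>brE. n_lie_bracket s n UNIV brE \<and> contains_subalgebra n g brg brE \<and>
             extreme n g V brE \<longrightarrow>
           (\<exists>\<Omega>. action_form_unified_product s n g V brg \<Omega> brE) \<and>
           extreme_action_datum s n g V (induced_datum g V brE) \<and>
           (3 \<le> n \<longrightarrow>
             action_form_unified_product s n g V brg (induced_datum g V brE) brE)) \<and>
         (\<forall>\<Omega>. extreme_action_datum s n g V \<Omega> \<and> compatibility_identities s n g V brg \<Omega> \<longrightarrow>
           n_lie_bracket s n UNIV (datum_bracket s n g V brg \<Omega>) \<and>
           contains_subalgebra n g brg (datum_bracket s n g V brg \<Omega>) \<and>
           extreme n g V (datum_bracket s n g V brg \<Omega>))"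
proof -
  interpret vector_space s by fact
  interpret char0_vector_space s ..
  note D = assms(3) and n = assms(2)
  have n0: "0 < n" using n by simp
  have brg: "alt n g g brg" using assms(4) by (simp add: n_lie_bracket_def)
  show ?thesis
  proof (intro conjI allI impI; elim conjE)
    fix brE assume "n_lie_bracket s n UNIV brE" "contains_subalgebra n g brg brE" "extreme n g V brE"
    note product = reduced_datum_product[OF D n this]
    then show "\<exists>\<Omega>. action_form_unified_product s n g V brg \<Omega> brE" by blast
    show "action_form_unified_product s n g V brg (induced_datum g V brE) brE" if "3 \<le> n"
      using product that by (simp add: reduced_datum_def)
  next
    fix brE assume "n_lie_bracket s n UNIV brE"
    then show "extreme_action_datum s n g V (induced_datum g V brE)"
      using induced_datum_extreme[OF D _ n0] by (simp add: n_lie_bracket_def)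
  next
    fix \<Omega> assume \<Omega>: "extreme_action_datum s n g V \<Omega>"
    show "contains_subalgebra n g brg (datum_bracket s n g V brg \<Omega>)"
      by (rule datum_bracket_contains[OF D n \<Omega>])
    show "extreme n g V (datum_bracket s n g V brg \<Omega>)"
      by (rule datum_bracket_extreme[OF D brg \<Omega>])
    assume "compatibility_identities s n g V brg \<Omega>"
    then show "n_lie_bracket s n UNIV (datum_bracket s n g V brg \<Omega>)"
      by (rule datum_bracket_n_lie[OF D brg n0 \<Omega>])
  qed
qed

end
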